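(* Consider units $i=1,\dots,n$ in the setting described in the context, and suppose: (Independence) $(Y_i(q,t),T_i(q))\perp Q_i\mid X_i$ for all $q,t\in\{0,1\}$; (Exclusion) $\mathbb{P}(Y_i(1,t)=Y_i(0,t)\mid X_i)=1$ a.s. for $t\in\{0,1\}$; (Relevance) $\mathbb{P}[T_i(1)\neq T_i(0)\mid X_i]>0$ a.s.; (Monotonicity) $\mathbb{P}[T_i(1)\geq T_i(0)\mid X_i]=1$ a.s. or $\mathbb{P}[T_i(1)\leq T_i(0)\mid X_i]=1$ a.s.; and (Group sizes) $m_g\geq 2$ and $n_g-m_g\geq 2$ for all $g=1,\dots,G$. Then $$\beta^{\mathrm{TSLS}}=\frac{\sum_{g=1}^G \frac{n_g}{n}\,\pi(x_g)^2\,\tilde V_g\,\tau(x_g)+\frac1n\sum_{i=1}^n\mathbb{E}[u_i\varepsilon_i\mid Q_i,X_i]P_{ii}}{\sum_{g=1}^G \frac{n_g}{n}\,\pi(x_g)^2\,\tilde V_g+\frac1n\sum_{i=1}^n\mathbb{E}[u_i^2\mid Q_i,X_i]P_{ii}},$$ where $\tilde V_g=\frac{m_g}{n_g}\left(1-\frac{m_g}{n_g}\right)$, $u_i=T_i-\mathbb{E}[T_i\mid Q_i,X_i]$, $\varepsilon_i=Y_i-\mathbb{E}[Y_i\mid Q_i,X_i]$, and $P_{ii}=\sum_{g=1}^G\frac{1}{n_g}W_{ig}\frac{(Z_{ig}-m_g/n_g)^2}{\tilde V_g}$ is the $i$-th diagonal element of $P$.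
   Context: Units $i=1,\dots,n$ are i.i.d. Each has a binary instrument $Q_i\in\{0,1\}$, a covariate vector $X_i$ taking values in a finite set $\{x_1,\dots,x_G\}$ of $G$ distinct values, potential treatments $T_i(q)\in\{0,1\}$ for $q\in\{0,1\}$, potential outcomes $Y_i(q,t)$ for $q,t\in\{0,1\}$; the observed treatment is $T_i=T_i(Q_i)$ and the observed outcome is $Y_i=Y_i(Q_i,T_i)$. Under exclusion write $Y_i(t)=Y_i(0,t)$. Let $\pi(x_g)=\mathbb{P}[T_i(1)\neq T_i(0)\mid X_i=x_g]$ and $\tau(x_g)=\mathbb{E}[Y_i(1)-Y_i(0)\mid T_i(1)\neq T_i(0),X_i=x_g]$. Let $Q=(Q_1,\dots,Q_n)$, $X=(X_1,\dots,X_n)$, $Y=(Y_1,\dots,Y_n)'$, $T=(T_1,\dots,T_n)'$. Let $W$ be the $n\times G$ matrix with $W_{ig}=\mathbb{1}[X_i=x_g]$ and $Z$ the $n\times G$ matrix with $Z_{ig}=Q_i\mathbb{1}[X_i=x_g]$; $n_g=\sum_iW_{ig}$, $m_g=\sum_i Z_{ig}$. Let $M_W=I_n-W(W'W)^{-1}W'$, $P=M_WZ(Z'M_WZ)^{-1}Z'M_W$, and $\beta^{\mathrm{TSLS}}=\mathbb{E}[T'PY\mid Q,X]/\mathbb{E}[T'PT\mid Q,X]$. *)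

theory Defs
  imports "HOL-Analysis.Analysis" "HOL-Probability.Probability"
begin

text \<open>All conditioning variables (instrument, covariates) are discrete, so conditional
  expectations/probabilities given them are elementary: conditioning on the event
  that they take their realized values.\<close>

definition condE :: "'a measure \<Rightarrow> 'a set \<Rightarrow> ('a \<Rightarrow> real) \<Rightarrow> real" where
  "condE N A f = (\<integral>\<omega>. indicator A \<omega> * f \<omega> \<partial>N) / measure N A"

definition condP :: "'a measure \<Rightarrow> 'a set \<Rightarrow> 'a set \<Rightarrow> real" where
  "condP N A B = measure N (A \<inter> B) / measure N A"

text \<open>A single unit lives on a probability space M. Q: instrument (True = 1),
  Tp q: potential treatment T(q) (True = 1), Yp q t: potential outcome Y(q,t),
  X: covariate with values in the type 'x.\<close>

definition Tobs :: "('a \<Rightarrow> bool) \<Rightarrow> (bool \<Rightarrow> 'a \<Rightarrow> bool) \<Rightarrow> 'a \<Rightarrow> real" where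
  "Tobs Q Tp \<omega> = (if Tp (Q \<omega>) \<omega> then 1 else 0)"

definition Yobs :: "('a \<Rightarrow> bool) \<Rightarrow> (bool \<Rightarrow> 'a \<Rightarrow> bool) \<Rightarrow> (bool \<Rightarrow> bool \<Rightarrow> 'a \<Rightarrow> real) \<Rightarrow> 'a \<Rightarrow> real" where
  "Yobs Q Tp Yp \<omega> = Yp (Q \<omega>) (Tp (Q \<omega>) \<omega>) \<omega>"

definition Xcell :: "'a measure \<Rightarrow> ('a \<Rightarrow> 'x) \<Rightarrow> 'x \<Rightarrow> 'a set" where
  "Xcell M X x = {\<omega> \<in> space M. X \<omega> = x}"

definition compliers :: "'a measure \<Rightarrow> (bool \<Rightarrow> 'a \<Rightarrow> bool) \<Rightarrow> 'a set" where
  "compliers M Tp = {\<omega> \<in> space M. Tp True \<omega> \<noteq> Tp False \<omega>}"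

definition pi_x :: "'a measure \<Rightarrow> ('a \<Rightarrow> 'x) \<Rightarrow> (bool \<Rightarrow> 'a \<Rightarrow> bool) \<Rightarrow> 'x \<Rightarrow> real" where
  "pi_x M X Tp x = condP M (Xcell M X x) (compliers M Tp)"

text \<open>tau(x) = E[Y(1) - Y(0) | T(1) ~= T(0), X = x], with Y(t) = Y(0,t)\<close>
definition tau_x :: "'a measure \<Rightarrow> ('a \<Rightarrow> 'x) \<Rightarrow> (bool \<Rightarrow> 'a \<Rightarrow> bool) \<Rightarrow> (bool \<Rightarrow> bool \<Rightarrow> 'a \<Rightarrow> real) \<Rightarrow> 'x \<Rightarrow> real" where
  "tau_x M X Tp Yp x = condE M (Xcell M X x \<inter> compliers M Tp) (\<lambda>\<omega>. Yp False True \<omega> - Yp False False \<omega>)"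

definition SampM :: "'a measure \<Rightarrow> ('n \<Rightarrow> 'a) measure" where
  "SampM M = PiM UNIV (\<lambda>_. M)"

definition QXevent :: "'a measure \<Rightarrow> ('a \<Rightarrow> bool) \<Rightarrow> ('a \<Rightarrow> 'x) \<Rightarrow> ('g \<Rightarrow> 'x)
    \<Rightarrow> ('n \<Rightarrow> bool) \<Rightarrow> ('n \<Rightarrow> 'g) \<Rightarrow> ('n \<Rightarrow> 'a) set" where
  "QXevent M Q X xs qv gv = {\<omega> \<in> space (SampM M). \<forall>i. Q (\<omega> i) = qv i \<and> X (\<omega> i) = xs (gv i)}"

definition QXevent_i :: "'a measure \<Rightarrow> ('a \<Rightarrow> bool) \<Rightarrow> ('a \<Rightarrow> 'x) \<Rightarrow> ('g \<Rightarrow> 'x)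
    \<Rightarrow> ('n \<Rightarrow> bool) \<Rightarrow> ('n \<Rightarrow> 'g) \<Rightarrow> 'n \<Rightarrow> ('n \<Rightarrow> 'a) set" where
  "QXevent_i M Q X xs qv gv i = {\<omega> \<in> space (SampM M). Q (\<omega> i) = qv i \<and> X (\<omega> i) = xs (gv i)}"

definition Wmat :: "('n \<Rightarrow> 'g) \<Rightarrow> real^'g^'n" where
  "Wmat gv = (\<chi> i g. if gv i = g then 1 else 0)"

definition Zmat :: "('n \<Rightarrow> bool) \<Rightarrow> ('n \<Rightarrow> 'g) \<Rightarrow> real^'g^'n" where
  "Zmat qv gv = (\<chi> i g. if qv i \<and> gv i = g then 1 else 0)"

definition n_g :: "('n::finite \<Rightarrow> 'g) \<Rightarrow> 'g \<Rightarrow> nat" where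
  "n_g gv g = card {i. gv i = g}"

definition m_g :: "('n::finite \<Rightarrow> bool) \<Rightarrow> ('n \<Rightarrow> 'g) \<Rightarrow> 'g \<Rightarrow> nat" where
  "m_g qv gv g = card {i. qv i \<and> gv i = g}"

definition MWmat :: "real^'g^'n \<Rightarrow> real^'n^'n" where
  "MWmat W = mat 1 - W ** matrix_inv (transpose W ** W) ** transpose W"

definition Pmat :: "real^'g^'n \<Rightarrow> real^'g^'n \<Rightarrow> real^'n^'n" where
  "Pmat W Z = MWmat W ** Z ** matrix_inv (transpose Z ** MWmat W ** Z) ** transpose Z ** MWmat W"

definition Tvec :: "('a \<Rightarrow> bool) \<Rightarrow> (bool \<Rightarrow> 'a \<Rightarrow> bool) \<Rightarrow> ('n \<Rightarrow> 'a) \<Rightarrow> real^'n" where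
  "Tvec Q Tp \<omega> = (\<chi> i. Tobs Q Tp (\<omega> i))"

definition Yvec :: "('a \<Rightarrow> bool) \<Rightarrow> (bool \<Rightarrow> 'a \<Rightarrow> bool) \<Rightarrow> (bool \<Rightarrow> bool \<Rightarrow> 'a \<Rightarrow> real) \<Rightarrow> ('n \<Rightarrow> 'a) \<Rightarrow> real^'n" where
  "Yvec Q Tp Yp \<omega> = (\<chi> i. Yobs Q Tp Yp (\<omega> i))"

definition beta_TSLS :: "'a measure \<Rightarrow> ('a \<Rightarrow> bool) \<Rightarrow> ('a \<Rightarrow> 'x) \<Rightarrow> (bool \<Rightarrow> 'a \<Rightarrow> bool)
    \<Rightarrow> (bool \<Rightarrow> bool \<Rightarrow> 'a \<Rightarrow> real) \<Rightarrow> ('g::finite \<Rightarrow> 'x) \<Rightarrow> ('n::finite \<Rightarrow> bool) \<Rightarrow> ('n \<Rightarrow> 'g) \<Rightarrow> real" where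
  "beta_TSLS M Q X Tp Yp xs qv gv =
     (let E = QXevent M Q X xs qv gv; P = Pmat (Wmat gv) (Zmat qv gv) in
      condE (SampM M) E (\<lambda>\<omega>. Tvec Q Tp \<omega> \<bullet> (P *v Yvec Q Tp Yp \<omega>))
      / condE (SampM M) E (\<lambda>\<omega>. Tvec Q Tp \<omega> \<bullet> (P *v Tvec Q Tp \<omega>)))"

definition E_u_eps :: "'a measure \<Rightarrow> ('a \<Rightarrow> bool) \<Rightarrow> ('a \<Rightarrow> 'x) \<Rightarrow> (bool \<Rightarrow> 'a \<Rightarrow> bool)
    \<Rightarrow> (bool \<Rightarrow> bool \<Rightarrow> 'a \<Rightarrow> real) \<Rightarrow> ('g \<Rightarrow> 'x) \<Rightarrow> ('n \<Rightarrow> bool) \<Rightarrow> ('n \<Rightarrow> 'g) \<Rightarrow> 'n \<Rightarrow> real" where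
  "E_u_eps M Q X Tp Yp xs qv gv i =
     (let D = QXevent_i M Q X xs qv gv i;
          T_i = (\<lambda>\<omega>. Tobs Q Tp (\<omega> i)); Y_i = (\<lambda>\<omega>. Yobs Q Tp Yp (\<omega> i)) in
      condE (SampM M) D (\<lambda>\<omega>. (T_i \<omega> - condE (SampM M) D T_i) * (Y_i \<omega> - condE (SampM M) D Y_i)))"

definition E_u_sq :: "'a measure \<Rightarrow> ('a \<Rightarrow> bool) \<Rightarrow> ('a \<Rightarrow> 'x) \<Rightarrow> (bool \<Rightarrow> 'a \<Rightarrow> bool)
    \<Rightarrow> ('g \<Rightarrow> 'x) \<Rightarrow> ('n \<Rightarrow> bool) \<Rightarrow> ('n \<Rightarrow> 'g) \<Rightarrow> 'n \<Rightarrow> real" where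
  "E_u_sq M Q X Tp xs qv gv i =
     (let D = QXevent_i M Q X xs qv gv i; T_i = (\<lambda>\<omega>. Tobs Q Tp (\<omega> i)) in
      condE (SampM M) D (\<lambda>\<omega>. (T_i \<omega> - condE (SampM M) D T_i)^2))"

end

theory Submission
  imports Defs
begin

text \<open>Given \<open>(Q, X)\<close> the units are independent and unit \<open>i\<close> lies in the cell
  \<open>{Q = q\<^sub>i, X = x\<^sub>g\<^sub>i}\<close>, so \<open>E[T'PY | Q, X]\<close> is the quadratic form of \<open>P\<close> in the cell
  means of \<open>T\<close> and \<open>Y\<close> plus the diagonal of \<open>P\<close> weighted by the within-cell covariances.
  Because \<open>P\<close> annihilates the group dummies, the cell means enter only through the instrument
  contrasts \<open>E[T | Q = 1, X = x\<^sub>g] - E[T | Q = 0, X = x\<^sub>g]\<close> (and likewise for \<open>Y\<close>),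
  weighted by \<open>n\<^sub>g Vtilde\<^sub>g\<close>. Independence turns these contrasts into
  \<open>E[T(1) - T(0) | X = x\<^sub>g]\<close> and \<open>E[Y(1, T(1)) - Y(0, T(0)) | X = x\<^sub>g]\<close>; by exclusion and
  monotonicity they equal \<open>s \<pi>(x\<^sub>g)\<close> and \<open>s \<pi>(x\<^sub>g) \<tau>(x\<^sub>g)\<close> for a sign \<open>s\<close> that
  cancels in the products.\<close>

section \<open>The projection matrix of the saturated design\<close>

lemma matrix_inv_unique:
  fixes A :: "'a::semiring_1^'n^'n"
  assumes AB: "A ** B = mat 1" and BA: "B ** A = mat 1"
  shows "matrix_inv A = B"
proof -
  have inv: "A ** matrix_inv A = mat 1 \<and> matrix_inv A ** A = mat 1"
    unfolding matrix_inv_def using AB BA by (intro someI_ex[of "\<lambda>C. A ** C = mat 1 \<and> C ** A = mat 1"]) blast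
  have "matrix_inv A = matrix_inv A ** (A ** B)"
    by (simp add: AB matrix_mul_rid)
  also have "\<dots> = B"
    using inv by (simp add: matrix_mul_assoc matrix_mul_lid)
  finally show ?thesis .
qed

definition diag_matrix :: "('n::finite \<Rightarrow> 'a::zero) \<Rightarrow> 'a^'n^'n" where
  "diag_matrix d = (\<chi> i j. if i = j then d i else 0)"

lemma diag_matrix_mult:
  "diag_matrix d ** diag_matrix e = diag_matrix (\<lambda>i. d i * e i :: 'a::semiring_1)"
  unfolding diag_matrix_def matrix_matrix_mult_def
  by (simp add: vec_eq_iff if_distrib[of "\<lambda>x. x * _"] cong: if_cong)

lemma matrix_inv_diag_matrix:
  fixes d :: "'n::finite \<Rightarrow> 'a::field"
  assumes "\<And>i. d i \<noteq> 0"
  shows "matrix_inv (diag_matrix d) = diag_matrix (\<lambda>i. inverse (d i))"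
proof -
  have one: "diag_matrix (\<lambda>_. 1) = (mat 1 :: 'a^'n^'n)"
    unfolding diag_matrix_def mat_def by (simp add: vec_eq_iff)
  show ?thesis
    by (rule matrix_inv_unique) (simp_all add: diag_matrix_mult assms one)
qed

lemma matrix_matrix_mult_diag_matrix_entry:
  "(A ** diag_matrix d ** B) $ i $ j = (\<Sum>k\<in>UNIV. A $ i $ k * d k * B $ k $ j :: 'a::semiring_1)"
  unfolding diag_matrix_def matrix_matrix_mult_def
  by (simp add: if_distrib[of "\<lambda>x. _ * x"] if_distrib[of "\<lambda>x. x * _"] cong: if_cong)

definition Vtilde :: "('n::finite \<Rightarrow> bool) \<Rightarrow> ('n \<Rightarrow> 'g) \<Rightarrow> 'g \<Rightarrow> real" where
  "Vtilde qv gv g = real (m_g qv gv g) / real (n_g gv g) * (1 - real (m_g qv gv g) / real (n_g gv g))"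

text \<open>Entry \<open>(i, g)\<close> of \<open>M\<^sub>W Z\<close>: the group-\<open>g\<close> instrument dummy centred at its
  group mean.\<close>
definition Zresid :: "('n::finite \<Rightarrow> bool) \<Rightarrow> ('n \<Rightarrow> 'g) \<Rightarrow> 'n \<Rightarrow> 'g \<Rightarrow> real" where
  "Zresid qv gv i g = (if gv i = g then of_bool (qv i) - real (m_g qv gv g) / real (n_g gv g) else 0)"

lemma m_g_le_n_g: "m_g qv gv g \<le> n_g gv g"
  unfolding m_g_def n_g_def by (rule card_mono) auto

lemma card_not_instrumented: "card {i. \<not> qv i \<and> gv i = g} = n_g gv g - m_g qv gv g"
proof -
  have "{i. gv i = g} = {i. qv i \<and> gv i = g} \<union> {i. \<not> qv i \<and> gv i = g}" by auto
  then have "n_g gv g = m_g qv gv g + card {i. \<not> qv i \<and> gv i = g}"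
    unfolding n_g_def m_g_def by (simp add: card_Un_disjoint[symmetric] disjoint_iff)
  then show ?thesis by simp
qed

lemma Vtilde_pos:
  assumes "0 < m_g qv gv g" "m_g qv gv g < n_g gv g"
  shows "0 < Vtilde qv gv g"
  using assms unfolding Vtilde_def by (simp add: field_simps)

lemma real_card_eq_sum: "real (card {i::'n::finite. P i}) = (\<Sum>i\<in>UNIV. if P i then 1 else 0)"
  by (simp add: sum.If_cases)

lemma Wmat_gram: "transpose (Wmat gv) ** Wmat gv = diag_matrix (\<lambda>g. real (n_g gv g))"
  unfolding diag_matrix_def matrix_matrix_mult_def transpose_def Wmat_def n_g_def
  by (auto simp: vec_eq_iff real_card_eq_sum intro!: sum.cong sum.neutral)

lemma MWmat_entry:
  assumes "\<And>g. 0 < n_g gv g"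
  shows "MWmat (Wmat gv) $ i $ j = of_bool (i = j) - (if gv i = gv j then 1 / real (n_g gv (gv i)) else 0)"
proof -
  have inv: "matrix_inv (transpose (Wmat gv) ** Wmat gv) = diag_matrix (\<lambda>g. 1 / real (n_g gv g))"
    unfolding Wmat_gram using assms by (subst matrix_inv_diag_matrix) (auto simp: inverse_eq_divide)
  show ?thesis
    unfolding MWmat_def inv
    by (simp add: matrix_matrix_mult_diag_matrix_entry transpose_def Wmat_def mat_def
        if_distrib[of "\<lambda>x. x * _"] if_distrib[of "\<lambda>x. x / _"] cong: if_cong)
qed

lemma transpose_MWmat:
  assumes "\<And>g. 0 < n_g gv g"
  shows "transpose (MWmat (Wmat gv)) = MWmat (Wmat gv)"
  by (auto simp: vec_eq_iff transpose_def MWmat_entry[OF assms])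

lemma MWmat_Zmat:
  assumes "\<And>g. 0 < n_g gv g"
  shows "MWmat (Wmat gv) ** Zmat qv gv = (\<chi> i g. Zresid qv gv i g)"
proof -
  have "(\<Sum>j\<in>UNIV. (if gv i = gv j then 1 / real (n_g gv (gv i)) else 0) * of_bool (qv j \<and> gv j = g))
     = (if gv i = g then real (m_g qv gv g) / real (n_g gv g) else 0)" for i g
    by (auto simp: m_g_def real_card_eq_sum sum_divide_distrib intro!: sum.cong sum.neutral)
  then show ?thesis
    by (simp add: vec_eq_iff matrix_matrix_mult_def MWmat_entry[OF assms] Zmat_def Zresid_def
        left_diff_distrib sum_subtractf of_bool_def[symmetric])
qed

lemma Zmat_MWmat_Zmat:
  assumes "\<And>g. 0 < n_g gv g"
  shows "transpose (Zmat qv gv) ** MWmat (Wmat gv) ** Zmat qv gv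
    = diag_matrix (\<lambda>g. real (n_g gv g) * Vtilde qv gv g)"
proof -
  have "(transpose (Zmat qv gv) ** (\<chi> i g. Zresid qv gv i g)) $ g $ h
      = (\<Sum>i | qv i \<and> gv i = g. Zresid qv gv i h)" for g h
    by (simp add: matrix_matrix_mult_def transpose_def Zmat_def if_distrib[of "\<lambda>x. x * _"] sum.If_cases)
  also have "\<dots> g h = (if g = h then real (n_g gv g) * Vtilde qv gv g else 0)" for g h
    using assms[of g] by (cases "g = h") (simp_all add: Zresid_def Vtilde_def m_g_def field_simps)
  finally show ?thesis
    unfolding matrix_mul_assoc[symmetric] MWmat_Zmat[OF assms]
    by (simp add: vec_eq_iff diag_matrix_def)
qed

lemma Pmat_entry:
  assumes "\<And>g. 0 < m_g qv gv g" "\<And>g. m_g qv gv g < n_g gv g"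
  shows "Pmat (Wmat gv) (Zmat qv gv) $ i $ j
    = (\<Sum>g\<in>UNIV. Zresid qv gv i g * Zresid qv gv j g / (real (n_g gv g) * Vtilde qv gv g))"
proof -
  have n_pos: "\<And>g. 0 < n_g gv g"
    using assms by (metis less_trans)
  have c_pos: "\<And>g. 0 < real (n_g gv g) * Vtilde qv gv g"
    using n_pos Vtilde_pos[OF assms] by (simp add: zero_less_mult_iff)
  define R where "R = MWmat (Wmat gv) ** Zmat qv gv"
  have "transpose R = transpose (Zmat qv gv) ** MWmat (Wmat gv)"
    unfolding R_def matrix_transpose_mul transpose_MWmat[OF n_pos] ..
  moreover have "matrix_inv (transpose (Zmat qv gv) ** MWmat (Wmat gv) ** Zmat qv gv)
      = diag_matrix (\<lambda>g. inverse (real (n_g gv g) * Vtilde qv gv g))"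
    unfolding Zmat_MWmat_Zmat[OF n_pos]
    by (intro matrix_inv_diag_matrix) (metis c_pos less_irrefl)
  ultimately have "Pmat (Wmat gv) (Zmat qv gv)
      = R ** diag_matrix (\<lambda>g. inverse (real (n_g gv g) * Vtilde qv gv g)) ** transpose R"
    unfolding Pmat_def R_def by (simp add: matrix_mul_assoc)
  then show ?thesis
    by (simp add: matrix_matrix_mult_diag_matrix_entry R_def MWmat_Zmat[OF n_pos] transpose_def
        divide_inverse mult_ac)
qed

text \<open>The residualised instrument is orthogonal to every group-level term \<open>a\<close>, so only the
  instrument effect \<open>d\<close> survives.\<close>
lemma sum_Zresid_mult:
  assumes "0 < n_g gv g"
  shows "(\<Sum>i\<in>UNIV. Zresid qv gv i g * (a (gv i) + of_bool (qv i) * d (gv i)))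
    = real (n_g gv g) * Vtilde qv gv g * d g"
proof -
  let ?n = "real (n_g gv g)" and ?m = "real (m_g qv gv g)"
  have "(\<Sum>i\<in>UNIV. Zresid qv gv i g * (a (gv i) + of_bool (qv i) * d (gv i)))
     = (\<Sum>i\<in>UNIV. (if qv i \<and> gv i = g then (1 - ?m / ?n) * (a g + d g) else 0)
                 + (if \<not> qv i \<and> gv i = g then (- ?m / ?n) * a g else 0))"
    by (intro sum.cong) (auto simp: Zresid_def)
  also have "\<dots> = ?m * ((1 - ?m / ?n) * (a g + d g)) + (?n - ?m) * ((- ?m / ?n) * a g)"
    by (simp add: sum.distrib sum.If_cases m_g_def card_not_instrumented m_g_le_n_g[unfolded m_g_def])
  also have "\<dots> = ?n * Vtilde qv gv g * d g"
    using assms by (simp add: Vtilde_def field_simps)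
  finally show ?thesis .
qed

lemma Pmat_quadratic_form:
  assumes "\<And>g. 0 < m_g qv gv g" "\<And>g. m_g qv gv g < n_g gv g"
  shows "(\<Sum>i\<in>UNIV. \<Sum>j\<in>UNIV. Pmat (Wmat gv) (Zmat qv gv) $ i $ j
            * (a (gv i) + of_bool (qv i) * d (gv i)) * (b (gv j) + of_bool (qv j) * e (gv j)))
       = (\<Sum>g\<in>UNIV. real (n_g gv g) * Vtilde qv gv g * d g * e g)"
proof -
  have n_pos: "\<And>g. 0 < n_g gv g"
    using assms by (metis less_trans)
  have V_nz: "real (n_g gv g) * Vtilde qv gv g \<noteq> 0" for g
    using n_pos[of g] Vtilde_pos[OF assms, of g] by simp
  let ?x = "\<lambda>i. a (gv i) + of_bool (qv i) * d (gv i)"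
  let ?y = "\<lambda>j. b (gv j) + of_bool (qv j) * e (gv j)"
  let ?c = "\<lambda>g. real (n_g gv g) * Vtilde qv gv g"
  have "(\<Sum>i\<in>UNIV. \<Sum>j\<in>UNIV. Pmat (Wmat gv) (Zmat qv gv) $ i $ j * ?x i * ?y j)
     = (\<Sum>i\<in>UNIV. \<Sum>j\<in>UNIV. \<Sum>g\<in>UNIV. (Zresid qv gv i g * ?x i) * (Zresid qv gv j g * ?y j) / ?c g)"
    by (intro sum.cong refl) (simp add: Pmat_entry[OF assms] sum_distrib_left sum_distrib_right mult_ac)
  also have "\<dots> = (\<Sum>i\<in>UNIV. \<Sum>g\<in>UNIV. \<Sum>j\<in>UNIV. (Zresid qv gv i g * ?x i) * (Zresid qv gv j g * ?y j) / ?c g)"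
    by (intro sum.cong refl sum.swap)
  also have "\<dots> = (\<Sum>g\<in>UNIV. \<Sum>i\<in>UNIV. \<Sum>j\<in>UNIV. (Zresid qv gv i g * ?x i) * (Zresid qv gv j g * ?y j) / ?c g)"
    by (rule sum.swap)
  also have "\<dots> = (\<Sum>g\<in>UNIV. (\<Sum>i\<in>UNIV. Zresid qv gv i g * ?x i) * (\<Sum>j\<in>UNIV. Zresid qv gv j g * ?y j) / ?c g)"
    by (simp add: sum_product sum_divide_distrib)
  also have "\<dots> = (\<Sum>g\<in>UNIV. ?c g * d g * e g)"
    by (intro sum.cong refl) (simp add: sum_Zresid_mult[OF n_pos] V_nz)
  finally show ?thesis .
qed

lemma Pmat_diag:
  assumes "\<And>g. 0 < m_g qv gv g" "\<And>g. m_g qv gv g < n_g gv g"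
  shows "Pmat (Wmat gv) (Zmat qv gv) $ i $ i
    = (\<Sum>g\<in>UNIV. 1 / real (n_g gv g) * Wmat gv $ i $ g
        * (Zmat qv gv $ i $ g - real (m_g qv gv g) / real (n_g gv g))^2 / Vtilde qv gv g)"
  unfolding Pmat_entry[OF assms]
  by (intro sum.cong refl) (auto simp: Zresid_def Wmat_def Zmat_def power2_eq_square)

section \<open>Conditional moments given an event\<close>

definition condCov :: "'a measure \<Rightarrow> 'a set \<Rightarrow> ('a \<Rightarrow> real) \<Rightarrow> ('a \<Rightarrow> real) \<Rightarrow> real" where
  "condCov N A f g = condE N A (\<lambda>\<omega>. f \<omega> * g \<omega>) - condE N A f * condE N A g"

lemma integrable_bounded_mult:
  fixes f g :: "'a \<Rightarrow> real"
  assumes f: "integrable M f" and g: "g \<in> borel_measurable M" and bound: "\<And>\<omega>. \<bar>g \<omega>\<bar> \<le> B"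
  shows "integrable M (\<lambda>\<omega>. g \<omega> * f \<omega>)"
proof (rule Bochner_Integration.integrable_bound[where f = "\<lambda>\<omega>. B * f \<omega>"])
  have "0 \<le> B" using bound[of undefined] by simp
  then show "AE \<omega> in M. norm (g \<omega> * f \<omega>) \<le> norm (B * f \<omega>)"
    using bound by (auto simp: abs_mult intro!: mult_right_mono)
qed (use f g in \<open>auto simp: borel_measurable_integrable\<close>)

lemma vimage_comp_subset_vimage:
  assumes Z: "Z \<in> M \<rightarrow>\<^sub>M N" and h: "h \<in> N \<rightarrow>\<^sub>M R"
  shows "{(h \<circ> Z) -` A \<inter> space M | A. A \<in> sets R} \<subseteq> {Z -` B \<inter> space M | B. B \<in> sets N}"
proof safe
  fix A assume "A \<in> sets R"
  then have "h -` A \<inter> space N \<in> sets N" using h by measurable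
  moreover have "(h \<circ> Z) -` A \<inter> space M = Z -` (h -` A \<inter> space N) \<inter> space M"
    using measurable_space[OF Z] by auto
  ultimately show "\<exists>B. (h \<circ> Z) -` A \<inter> space M = Z -` B \<inter> space M \<and> B \<in> sets N"
    by blast
qed

context prob_space
begin

lemma integrable_indicator_mult:
  "A \<in> events \<Longrightarrow> integrable M f \<Longrightarrow> integrable M (\<lambda>\<omega>. indicator A \<omega> * f \<omega> :: real)"
  using integrable_real_mult_indicator[of A M f] by (simp add: mult.commute)

lemma condE_const:
  assumes "A \<in> events" "prob A \<noteq> 0"
  shows "condE M A (\<lambda>_. c) = c"
  using assms unfolding condE_def by simp

lemma condE_cmult: "condE M A (\<lambda>\<omega>. c * f \<omega>) = c * condE M A f"
  unfolding condE_def by (simp add: mult.left_commute)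

lemma condE_add:
  assumes "A \<in> events" "integrable M f" "integrable M g"
  shows "condE M A (\<lambda>\<omega>. f \<omega> + g \<omega>) = condE M A f + condE M A g"
  unfolding condE_def using assms
  by (simp add: distrib_left integrable_indicator_mult add_divide_distrib)

lemma condE_diff:
  assumes "A \<in> events" "integrable M f" "integrable M g"
  shows "condE M A (\<lambda>\<omega>. f \<omega> - g \<omega>) = condE M A f - condE M A g"
  unfolding condE_def using assms
  by (simp add: right_diff_distrib integrable_indicator_mult diff_divide_distrib)

lemma condE_sum:
  assumes "finite I" "\<And>i. i \<in> I \<Longrightarrow> integrable M (G i)" "A \<in> events"
  shows "condE M A (\<lambda>\<omega>. \<Sum>i\<in>I. c i * G i \<omega>) = (\<Sum>i\<in>I. c i * condE M A (G i))"
proof -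
  have "(\<integral>\<omega>. indicator A \<omega> * (\<Sum>i\<in>I. c i * G i \<omega>) \<partial>M) = (\<integral>\<omega>. (\<Sum>i\<in>I. c i * (indicator A \<omega> * G i \<omega>)) \<partial>M)"
    by (simp add: sum_distrib_left mult_ac)
  also have "\<dots> = (\<Sum>i\<in>I. c i * (\<integral>\<omega>. indicator A \<omega> * G i \<omega> \<partial>M))"
    using assms by (subst Bochner_Integration.integral_sum) (auto intro: integrable_indicator_mult)
  finally show ?thesis
    unfolding condE_def by (simp add: sum_divide_distrib)
qed

lemma condE_centred_mult:
  assumes A: "A \<in> events" "prob A \<noteq> 0"
    and f: "integrable M f" and g: "integrable M g" and fg: "integrable M (\<lambda>\<omega>. f \<omega> * g \<omega>)"
  shows "condE M A (\<lambda>\<omega>. (f \<omega> - condE M A f) * (g \<omega> - condE M A g)) = condCov M A f g"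
proof -
  define a b where "a = condE M A f" and "b = condE M A g"
  have "indicator A \<omega> * ((f \<omega> - a) * (g \<omega> - b))
      = indicator A \<omega> * (f \<omega> * g \<omega>) - b * (indicator A \<omega> * f \<omega>) - a * (indicator A \<omega> * g \<omega>)
        + a * b * indicator A \<omega>" for \<omega>
    by (simp add: algebra_simps)
  then have "(\<integral>\<omega>. indicator A \<omega> * ((f \<omega> - a) * (g \<omega> - b)) \<partial>M)
      = (\<integral>\<omega>. indicator A \<omega> * (f \<omega> * g \<omega>) \<partial>M) - b * (\<integral>\<omega>. indicator A \<omega> * f \<omega> \<partial>M)
        - a * (\<integral>\<omega>. indicator A \<omega> * g \<omega> \<partial>M) + a * b * prob A"
    using A integrable_indicator_mult[OF A(1) f] integrable_indicator_mult[OF A(1) g]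
      integrable_indicator_mult[OF A(1) fg] by (simp add: emeasure_eq_measure)
  then show ?thesis
    using A unfolding condCov_def condE_def a_def b_def by (simp add: field_simps)
qed

lemma condE_cong_AE:
  assumes "AE \<omega> in M. \<omega> \<in> A \<longrightarrow> f \<omega> = g \<omega>" "A \<in> events"
    "f \<in> borel_measurable M" "g \<in> borel_measurable M"
  shows "condE M A f = condE M A g"
  unfolding condE_def using assms
  by (intro arg_cong[where f = "\<lambda>x. x / prob A"] integral_cong_AE) (auto simp: indicator_def)

lemma condE_indicator_mult:
  assumes "B \<subseteq> A" "A \<in> events" "B \<in> events"
  shows "condE M A (\<lambda>\<omega>. indicator B \<omega> * f \<omega>) = condP M A B * condE M B f"
proof (cases "prob B = 0")
  case True
  then have "AE \<omega> in M. \<omega> \<notin> B"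
    using assms by (intro AE_not_in) (simp add: null_sets_def emeasure_eq_measure)
  then have "(\<integral>\<omega>. indicator A \<omega> * (indicator B \<omega> * f \<omega>) \<partial>M) = 0"
    by (intro integral_eq_zero_AE) (auto elim: AE_mp)
  then show ?thesis
    using True unfolding condE_def condP_def by simp
next
  case False
  have "(\<lambda>\<omega>. indicator A \<omega> * (indicator B \<omega> * f \<omega>)) = (\<lambda>\<omega>. indicator B \<omega> * f \<omega>)"
    using assms(1) by (auto simp: fun_eq_iff indicator_def)
  then show ?thesis
    using False assms(1) unfolding condE_def condP_def by (simp add: Int_absorb1)
qed

lemma condE_indicator:
  assumes "B \<subseteq> A" "B \<in> events"
  shows "condE M A (indicator B) = condP M A B"
proof -
  have "(\<lambda>\<omega>. indicator A \<omega> * indicator B \<omega>) = (indicator B :: 'a \<Rightarrow> real)"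
    using assms(1) by (auto simp: fun_eq_iff indicator_def)
  then show ?thesis
    using assms unfolding condE_def condP_def by (simp add: Int_absorb1)
qed

lemma AE_of_condP_eq_1:
  assumes "A \<in> events" "B \<in> events" "0 < prob A" "condP M A B = 1"
  shows "AE \<omega> in M. \<omega> \<in> A \<longrightarrow> \<omega> \<in> B"
proof (rule AE_I[where N = "A - B"])
  have "prob (A \<inter> B) = prob A"
    using assms unfolding condP_def by (simp add: field_simps)
  then have "prob (A - B) = 0"
    using finite_measure_Diff'[OF assms(1,2)] by simp
  then show "emeasure M (A - B) = 0"
    using assms by (simp add: emeasure_eq_measure)
qed (use assms in auto)

lemma integral_uniform_measure:
  fixes f :: "'a \<Rightarrow> real"
  assumes A: "A \<in> events" "0 < prob A" and f: "f \<in> borel_measurable M"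
  shows "integral\<^sup>L (uniform_measure M A) f = condE M A f"
    and "integrable (uniform_measure M A) f \<longleftrightarrow> integrable M (\<lambda>\<omega>. indicator A \<omega> * f \<omega>)"
proof -
  have density: "uniform_measure M A = density M (\<lambda>\<omega>. ennreal (indicator A \<omega> / prob A))"
    unfolding uniform_measure_def using A
    by (auto simp: emeasure_eq_measure divide_ennreal ennreal_indicator[symmetric] intro!: arg_cong2[where f = density])
  have [measurable]: "A \<in> sets M" using A by simp
  show "integral\<^sup>L (uniform_measure M A) f = condE M A f"
    unfolding density condE_def using A f by (subst integral_density) (auto simp: integral_divide_zero)
  have "integrable (uniform_measure M A) f \<longleftrightarrow> integrable M (\<lambda>\<omega>. (1 / prob A) * (indicator A \<omega> * f \<omega>))"
    unfolding density using A f by (subst integrable_density) auto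
  also have "\<dots> \<longleftrightarrow> integrable M (\<lambda>\<omega>. indicator A \<omega> * f \<omega>)"
    using A by (subst integrable_mult_left_iff) auto
  finally show "integrable (uniform_measure M A) f \<longleftrightarrow> integrable M (\<lambda>\<omega>. indicator A \<omega> * f \<omega>)" .
qed

lemma indep_var_compose_of_indep_set:
  assumes indep: "indep_set {X -` A \<inter> space M | A. A \<in> sets S} {Y -` B \<inter> space M | B. B \<in> sets T}"
    and X: "random_variable S X" and Y: "random_variable T Y"
    and f: "f \<in> S \<rightarrow>\<^sub>M R" and g: "g \<in> T \<rightarrow>\<^sub>M R"
  shows "indep_var R (f \<circ> X) R (g \<circ> Y)"
proof -
  have "indep_set {(f \<circ> X) -` A \<inter> space M | A. A \<in> sets R} {(g \<circ> Y) -` A \<inter> space M | A. A \<in> sets R}"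
    using indep unfolding indep_set_def
    by (rule indep_sets_mono_sets) (use vimage_comp_subset_vimage[OF X f] vimage_comp_subset_vimage[OF Y g] in \<open>auto split: bool.split\<close>)
  moreover have "random_variable R (f \<circ> X)" "random_variable R (g \<circ> Y)"
    using X Y f g by (auto intro: measurable_comp)
  moreover have "(\<lambda>i. {case_bool (f \<circ> X) (g \<circ> Y) i -` A \<inter> space M | A. A \<in> sets (case_bool R R i)})
      = case_bool {(f \<circ> X) -` A \<inter> space M | A. A \<in> sets R} {(g \<circ> Y) -` A \<inter> space M | A. A \<in> sets R}"
    by (simp add: fun_eq_iff split: bool.split)
  ultimately show ?thesis
    unfolding indep_var_def indep_vars_def2 indep_set_def by (simp split: bool.split)
qed

text \<open>Under the conditional law given \<open>C\<close>, \<open>\<phi>(V)\<close> and the indicator of \<open>Q = q\<close> are independent,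
  so their product has mean \<open>E[\<phi>(V) | C] P(Q = q | C)\<close>.\<close>
lemma condE_refine_indep:
  fixes V :: "'a \<Rightarrow> 'b" and Q :: "'a \<Rightarrow> 'c"
  assumes C: "C \<in> events" and pos: "0 < prob {\<omega> \<in> C. Q \<omega> = q}"
    and indep: "prob_space.indep_set (uniform_measure M C)
          {V -` A \<inter> space M | A. A \<in> sets N} {Q -` B \<inter> space M | B. B \<in> sets (count_space UNIV)}"
    and V: "V \<in> M \<rightarrow>\<^sub>M N" and Q: "Q \<in> M \<rightarrow>\<^sub>M count_space UNIV"
    and \<phi>: "\<phi> \<in> borel_measurable N" and int: "integrable M (\<lambda>\<omega>. \<phi> (V \<omega>))"
  shows "condE M {\<omega> \<in> C. Q \<omega> = q} (\<lambda>\<omega>. \<phi> (V \<omega>)) = condE M C (\<lambda>\<omega>. \<phi> (V \<omega>))"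
proof -
  define Cq where "Cq = {\<omega> \<in> C. Q \<omega> = q}"
  define \<psi> :: "'c \<Rightarrow> real" where "\<psi> b = of_bool (b = q)" for b
  have "Cq = C \<inter> (Q -` {q} \<inter> space M)"
    unfolding Cq_def using sets.sets_into_space[OF C] by auto
  then have Cq: "Cq \<in> events" "Cq \<subseteq> C"
    using C measurable_sets[OF Q, of "{q}"] by auto
  have C_pos: "0 < prob C"
    using pos finite_measure_mono[OF Cq(2) C] unfolding Cq_def by linarith
  interpret U: prob_space "uniform_measure M C"
    using C C_pos by (intro prob_space_uniform_measure) (auto simp: emeasure_eq_measure)
  have [measurable]: "\<phi> \<circ> V \<in> borel_measurable M" "\<psi> \<circ> Q \<in> borel_measurable M"
    using V \<phi> Q by (auto simp: \<psi>_def)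
  have "U.indep_var borel (\<phi> \<circ> V) borel (\<psi> \<circ> Q)"
    by (rule U.indep_var_compose_of_indep_set[where S = N and T = "count_space UNIV"])
       (use indep V Q \<phi> in auto)
  moreover have "integrable (uniform_measure M C) (\<phi> \<circ> V)"
    using int C C_pos by (simp add: integral_uniform_measure comp_def integrable_indicator_mult)
  moreover have "integrable (uniform_measure M C) (\<psi> \<circ> Q)"
    by (rule U.integrable_const_bound[where B = 1]) (simp_all add: \<psi>_def)
  ultimately have "condE M C (\<lambda>\<omega>. \<phi> (V \<omega>) * \<psi> (Q \<omega>)) = condE M C (\<lambda>\<omega>. \<phi> (V \<omega>)) * condE M C (\<lambda>\<omega>. \<psi> (Q \<omega>))"
    using U.indep_var_lebesgue_integral C C_pos by (simp add: integral_uniform_measure[symmetric] comp_def)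
  moreover have "condE M C (\<lambda>\<omega>. \<phi> (V \<omega>) * \<psi> (Q \<omega>)) = condE M C (\<lambda>\<omega>. indicator Cq \<omega> * \<phi> (V \<omega>))"
    using C V Q \<phi> Cq(1) by (intro condE_cong_AE AE_I2) (auto simp: Cq_def \<psi>_def)
  moreover have "condE M C (\<lambda>\<omega>. \<psi> (Q \<omega>)) = condE M C (indicator Cq)"
    using C Q Cq(1) by (intro condE_cong_AE AE_I2) (auto simp: Cq_def \<psi>_def)
  moreover have "0 < condP M C Cq"
    using pos C_pos unfolding Cq_def condP_def by (simp add: Int_absorb1)
  ultimately show ?thesis
    using Cq C by (simp add: condE_indicator_mult condE_indicator Cq_def)
qed

section \<open>Conditioning the i.i.d. sample on a box\<close>

lemma indicator_PiE_UNIV: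
  fixes A :: "'n::finite \<Rightarrow> 'a set"
  shows "indicator (Pi\<^sub>E UNIV A) \<omega> = (\<Prod>k\<in>UNIV. indicator (A k) (\<omega> k) :: real)"
proof (cases "\<omega> \<in> Pi\<^sub>E UNIV A")
  case False
  then obtain k where "\<omega> k \<notin> A k" by (auto simp: PiE_iff)
  then have "(\<Prod>k\<in>UNIV. indicator (A k) (\<omega> k) :: real) = 0"
    by (intro prod_zero) (auto intro!: exI[of _ k])
  then show ?thesis using False by simp
qed (simp add: PiE_iff)

lemma product_prob_space_iid: "product_prob_space (\<lambda>_::'n. M)"
  using prob_space_axioms
  by (simp add: product_prob_space_def product_prob_space_axioms_def product_sigma_finite_def
      prob_space_imp_sigma_finite)

lemma prob_space_SampM: "prob_space (SampM M)"
  unfolding SampM_def by (intro prob_space_PiM prob_space_axioms)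

lemma box_in_sets_SampM:
  fixes A :: "'n::finite \<Rightarrow> 'a set"
  assumes "\<And>k. A k \<in> events"
  shows "Pi\<^sub>E UNIV A \<in> sets (SampM M)"
  unfolding SampM_def using assms by (intro sets_PiM_I_finite) auto

lemma
  fixes h :: "'n::finite \<Rightarrow> 'a \<Rightarrow> real"
  assumes A: "\<And>k. A k \<in> events" and h: "\<And>k. integrable M (h k)"
  shows integral_SampM_box_prod: "(\<integral>\<omega>. indicator (Pi\<^sub>E UNIV A) \<omega> * (\<Prod>k\<in>UNIV. h k (\<omega> k)) \<partial>SampM M)
           = (\<Prod>k\<in>UNIV. \<integral>x. indicator (A k) x * h k x \<partial>M)"
    and integrable_SampM_prod: "integrable (SampM M) (\<lambda>\<omega>. \<Prod>k\<in>UNIV. h k (\<omega> k))"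
proof -
  interpret P: product_prob_space "\<lambda>_::'n. M" by (rule product_prob_space_iid)
  have "indicator (Pi\<^sub>E UNIV A) \<omega> * (\<Prod>k\<in>UNIV. h k (\<omega> k)) = (\<Prod>k\<in>UNIV. indicator (A k) (\<omega> k) * h k (\<omega> k))" for \<omega>
    by (simp add: indicator_PiE_UNIV prod.distrib)
  then show "(\<integral>\<omega>. indicator (Pi\<^sub>E UNIV A) \<omega> * (\<Prod>k\<in>UNIV. h k (\<omega> k)) \<partial>SampM M)
           = (\<Prod>k\<in>UNIV. \<integral>x. indicator (A k) x * h k x \<partial>M)"
    unfolding SampM_def using A h
    by (simp add: P.product_integral_prod[where f = "\<lambda>k x. indicator (A k) x * h k x"] integrable_indicator_mult)
  show "integrable (SampM M) (\<lambda>\<omega>. \<Prod>k\<in>UNIV. h k (\<omega> k))"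
    unfolding SampM_def using h by (intro P.product_integrable_prod) auto
qed

lemma measure_SampM_box:
  fixes A :: "'n::finite \<Rightarrow> 'a set"
  assumes "\<And>k. A k \<in> events"
  shows "measure (SampM M) (Pi\<^sub>E UNIV A) = (\<Prod>k\<in>UNIV. prob (A k))"
  using integral_SampM_box_prod[where A = A and h = "\<lambda>_ _. 1", OF assms] box_in_sets_SampM[where A = A, OF assms]
    assms by (simp add: sets.Int_space_eq2)

lemma condE_SampM_box_prod:
  fixes h :: "'n::finite \<Rightarrow> 'a \<Rightarrow> real"
  assumes "\<And>k. A k \<in> events" "\<And>k. integrable M (h k)"
  shows "condE (SampM M) (Pi\<^sub>E UNIV A) (\<lambda>\<omega>. \<Prod>k\<in>UNIV. h k (\<omega> k)) = (\<Prod>k\<in>UNIV. condE M (A k) (h k))"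
  unfolding condE_def integral_SampM_box_prod[OF assms] measure_SampM_box[OF assms(1)]
  by (simp add: prod_dividef)

lemma
  fixes A :: "'n::finite \<Rightarrow> 'a set"
  assumes A: "\<And>k. A k \<in> events" "\<And>k. 0 < prob (A k)" and f: "integrable M f"
  shows condE_SampM_box_coord: "condE (SampM M) (Pi\<^sub>E UNIV A) (\<lambda>\<omega>. f (\<omega> i)) = condE M (A i) f"
    and integrable_SampM_coord: "integrable (SampM M) (\<lambda>\<omega>. f (\<omega> i))"
proof -
  define h where "h k = (if k = i then f else (\<lambda>_. 1))" for k
  have h: "integrable M (h k)" for k
    unfolding h_def using f by simp
  have "(\<Prod>k\<in>UNIV. h k (\<omega> k)) = f (\<omega> i)" for \<omega>
    unfolding h_def by (simp add: if_distrib[of "\<lambda>h. h _"] prod.delta' cong: if_cong)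
  moreover have "(\<Prod>k\<in>UNIV. condE M (A k) (h k)) = condE M (A i) f"
    using A unfolding h_def by (simp add: if_distrib[of "condE M _"] condE_const order_less_imp_not_eq2 prod.delta' cong: if_cong)
  ultimately show "condE (SampM M) (Pi\<^sub>E UNIV A) (\<lambda>\<omega>. f (\<omega> i)) = condE M (A i) f"
    "integrable (SampM M) (\<lambda>\<omega>. f (\<omega> i))"
    using condE_SampM_box_prod[where A = A and h = h, OF A(1) h]
      integrable_SampM_prod[where A = A and h = h, OF A(1) h] by simp_all
qed

lemma
  fixes A :: "'n::finite \<Rightarrow> 'a set"
  assumes A: "\<And>k. A k \<in> events" "\<And>k. 0 < prob (A k)"
    and f: "integrable M f" and g: "integrable M g" and "i \<noteq> j"
  shows condE_SampM_box_coord_pair: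
      "condE (SampM M) (Pi\<^sub>E UNIV A) (\<lambda>\<omega>. f (\<omega> i) * g (\<omega> j)) = condE M (A i) f * condE M (A j) g"
    and integrable_SampM_coord_pair: "integrable (SampM M) (\<lambda>\<omega>. f (\<omega> i) * g (\<omega> j))"
proof -
  define h where "h k = (if k = i then f else if k = j then g else (\<lambda>_. 1))" for k
  have h: "integrable M (h k)" for k
    unfolding h_def using f g by simp
  have split: "(\<Prod>k\<in>UNIV. u k) = u i * u j" if "\<And>k. k \<noteq> i \<Longrightarrow> k \<noteq> j \<Longrightarrow> u k = 1" for u :: "'n \<Rightarrow> real"
  proof -
    have "(\<Prod>k\<in>UNIV. u k) = (\<Prod>k\<in>{i, j}. u k)"
      using that by (intro prod.mono_neutral_right) auto
    then show ?thesis using \<open>i \<noteq> j\<close> by simp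
  qed
  have "(\<Prod>k\<in>UNIV. h k (\<omega> k)) = f (\<omega> i) * g (\<omega> j)" for \<omega>
    using \<open>i \<noteq> j\<close> by (subst split) (auto simp: h_def)
  moreover have "(\<Prod>k\<in>UNIV. condE M (A k) (h k)) = condE M (A i) f * condE M (A j) g"
    using A \<open>i \<noteq> j\<close> by (subst split) (auto simp: h_def condE_const order_less_imp_not_eq2)
  ultimately show "condE (SampM M) (Pi\<^sub>E UNIV A) (\<lambda>\<omega>. f (\<omega> i) * g (\<omega> j)) = condE M (A i) f * condE M (A j) g"
    "integrable (SampM M) (\<lambda>\<omega>. f (\<omega> i) * g (\<omega> j))"
    using condE_SampM_box_prod[where A = A and h = h, OF A(1) h]
      integrable_SampM_prod[where A = A and h = h, OF A(1) h] by simp_all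
qed

lemma condE_SampM_box_bilinear:
  fixes A :: "'n::finite \<Rightarrow> 'a set" and P :: "real^'n^'n"
  assumes A: "\<And>k. A k \<in> events" "\<And>k. 0 < prob (A k)"
    and f: "integrable M f" and g: "integrable M g" and fg: "integrable M (\<lambda>x. f x * g x)"
  shows "condE (SampM M) (Pi\<^sub>E UNIV A) (\<lambda>\<omega>. (\<chi> i. f (\<omega> i)) \<bullet> (P *v (\<chi> i. g (\<omega> i))))
    = (\<Sum>i\<in>UNIV. \<Sum>j\<in>UNIV. P $ i $ j * condE M (A i) f * condE M (A j) g)
      + (\<Sum>i\<in>UNIV. P $ i $ i * condCov M (A i) f g)"
proof -
  interpret S: prob_space "SampM M" by (rule prob_space_SampM)
  define G where "G i j \<omega> = f (\<omega> i) * g (\<omega> j)" for i j :: 'n and \<omega>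
  have G_int: "integrable (SampM M) (G i j)" for i j
    using integrable_SampM_coord[of A _ i, OF A fg] integrable_SampM_coord_pair[of A f g i j, OF A f g]
    unfolding G_def by (cases "i = j") simp_all
  have G_condE: "condE (SampM M) (Pi\<^sub>E UNIV A) (G i j)
      = condE M (A i) f * condE M (A j) g + (if i = j then condCov M (A i) f g else 0)" for i j
    using condE_SampM_box_coord[of A _ i, OF A fg] condE_SampM_box_coord_pair[of A f g i j, OF A f g]
    unfolding G_def condCov_def by (cases "i = j") simp_all
  have pairs: "(\<Sum>p\<in>UNIV. F (fst p) (snd p)) = (\<Sum>i\<in>UNIV. \<Sum>j\<in>UNIV. F i j)" for F :: "'n \<Rightarrow> 'n \<Rightarrow> real"
    by (simp add: sum.cartesian_product case_prod_unfold flip: UNIV_Times_UNIV)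
  have "(\<chi> i. f (\<omega> i)) \<bullet> (P *v (\<chi> i. g (\<omega> i))) = (\<Sum>p\<in>UNIV. P $ fst p $ snd p * G (fst p) (snd p) \<omega>)" for \<omega>
    unfolding pairs[of "\<lambda>i j. P $ i $ j * G i j \<omega>"]
    by (simp add: inner_vec_def matrix_vector_mult_def sum_distrib_left G_def mult_ac)
  then have "condE (SampM M) (Pi\<^sub>E UNIV A) (\<lambda>\<omega>. (\<chi> i. f (\<omega> i)) \<bullet> (P *v (\<chi> i. g (\<omega> i))))
      = (\<Sum>p\<in>UNIV. P $ fst p $ snd p * condE (SampM M) (Pi\<^sub>E UNIV A) (G (fst p) (snd p)))"
    using G_int box_in_sets_SampM[where A = A, OF A(1)] by (simp add: S.condE_sum)
  also have "\<dots> = (\<Sum>i\<in>UNIV. \<Sum>j\<in>UNIV. P $ i $ j * condE (SampM M) (Pi\<^sub>E UNIV A) (G i j))"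
    by (rule pairs)
  finally show ?thesis
    by (simp add: G_condE distrib_left sum.distrib mult_ac if_distrib[of "\<lambda>x. _ * x"] cong: if_cong)
qed

end

section \<open>The instrumental variable model\<close>

locale iv_model = prob_space M
  for M :: "'a measure"
    and Q :: "'a \<Rightarrow> bool"
    and X :: "'a \<Rightarrow> 'x"
    and Tp :: "bool \<Rightarrow> 'a \<Rightarrow> bool"
    and Yp :: "bool \<Rightarrow> bool \<Rightarrow> 'a \<Rightarrow> real"
    and xs :: "'g::finite \<Rightarrow> 'x" +
  assumes Q_measurable[measurable]: "Q \<in> M \<rightarrow>\<^sub>M count_space UNIV"
    and X_measurable[measurable]: "X \<in> M \<rightarrow>\<^sub>M count_space UNIV"
    and Tp_measurable[measurable]: "\<And>q. Tp q \<in> M \<rightarrow>\<^sub>M count_space UNIV"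
    and Yp_measurable[measurable]: "\<And>q t. Yp q t \<in> borel_measurable M"
    and Yp_integrable: "\<And>q t. integrable M (Yp q t)"
    and independence: "\<And>q t g. 0 < prob (Xcell M X (xs g)) \<Longrightarrow>
        prob_space.indep_set (uniform_measure M (Xcell M X (xs g)))
          {(\<lambda>\<omega>. (Yp q t \<omega>, Tp q \<omega>)) -` A \<inter> space M | A. A \<in> sets (borel \<Otimes>\<^sub>M count_space UNIV)}
          {Q -` B \<inter> space M | B. B \<in> sets (count_space UNIV)}"
    and exclusion: "\<And>t g. 0 < prob (Xcell M X (xs g)) \<Longrightarrow>
        condP M (Xcell M X (xs g)) {\<omega> \<in> space M. Yp True t \<omega> = Yp False t \<omega>} = 1"
    and monotonicity: "\<And>g. 0 < prob (Xcell M X (xs g)) \<Longrightarrow>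
        condP M (Xcell M X (xs g)) {\<omega> \<in> space M. Tp True \<omega> \<ge> Tp False \<omega>} = 1 \<or>
        condP M (Xcell M X (xs g)) {\<omega> \<in> space M. Tp True \<omega> \<le> Tp False \<omega>} = 1"
begin

definition cell :: "bool \<Rightarrow> 'g \<Rightarrow> 'a set" where
  "cell q g = {\<omega> \<in> Xcell M X (xs g). Q \<omega> = q}"

definition iv_contrast :: "('a \<Rightarrow> real) \<Rightarrow> 'g \<Rightarrow> real" where
  "iv_contrast f g = condE M (cell True g) f - condE M (cell False g) f"

lemma Xcell_in_events[measurable]: "Xcell M X x \<in> events"
proof -
  have "Xcell M X x = X -` {x} \<inter> space M" unfolding Xcell_def by auto
  then show ?thesis by simp
qed

lemma cell_in_events[measurable]: "cell q g \<in> events"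
proof -
  have "cell q g = Xcell M X (xs g) \<inter> (Q -` {q} \<inter> space M)" unfolding cell_def Xcell_def by auto
  then show ?thesis by simp
qed

lemma cell_subset_Xcell: "cell q g \<subseteq> Xcell M X (xs g)"
  unfolding cell_def by auto

lemma Xcell_pos_of_cell_pos: "0 < prob (cell q g) \<Longrightarrow> 0 < prob (Xcell M X (xs g))"
  using finite_measure_mono[OF cell_subset_Xcell[of q g] Xcell_in_events] by linarith

lemma Tobs_measurable[measurable]: "Tobs Q Tp \<in> borel_measurable M"
  unfolding Tobs_def[abs_def] by measurable

lemma Yobs_measurable[measurable]: "Yobs Q Tp Yp \<in> borel_measurable M"
  unfolding Yobs_def[abs_def] by measurable

lemma integrable_Tobs_mult: "integrable M f \<Longrightarrow> integrable M (\<lambda>\<omega>. Tobs Q Tp \<omega> * f \<omega>)"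
  by (rule integrable_bounded_mult[where B = 1]) (auto simp: Tobs_def)

lemma integrable_Tobs: "integrable M (Tobs Q Tp)"
  using integrable_Tobs_mult[of "\<lambda>_. 1"] by simp

lemma integrable_Yobs: "integrable M (Yobs Q Tp Yp)"
proof -
  have eq: "Yobs Q Tp Yp = (\<lambda>\<omega>. of_bool (Q \<omega> \<and> Tp True \<omega>) * Yp True True \<omega>
      + of_bool (Q \<omega> \<and> \<not> Tp True \<omega>) * Yp True False \<omega>
      + of_bool (\<not> Q \<omega> \<and> Tp False \<omega>) * Yp False True \<omega>
      + of_bool (\<not> Q \<omega> \<and> \<not> Tp False \<omega>) * Yp False False \<omega>)"
    by (auto simp: fun_eq_iff Yobs_def)
  show ?thesis
    unfolding eq
    by (intro Bochner_Integration.integrable_add integrable_bounded_mult[where B = 1] Yp_integrable;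
        (measurable | simp))
qed

lemma integrable_Yp_Tp: "integrable M (\<lambda>\<omega>. Yp q (Tp q \<omega>) \<omega>)"
proof -
  have eq: "(\<lambda>\<omega>. Yp q (Tp q \<omega>) \<omega>)
      = (\<lambda>\<omega>. of_bool (Tp q \<omega>) * Yp q True \<omega> + of_bool (\<not> Tp q \<omega>) * Yp q False \<omega>)"
    by (auto simp: fun_eq_iff)
  show ?thesis
    unfolding eq
    by (intro Bochner_Integration.integrable_add integrable_bounded_mult[where B = 1] Yp_integrable;
        (measurable | simp))
qed

lemma integrable_of_bool_Tp: "integrable M (\<lambda>\<omega>. of_bool (Tp q \<omega>) :: real)"
  by (rule integrable_const_bound[where B = 1]) auto

lemma condE_cell_eq_condE_Xcell:
  assumes pos: "0 < prob (cell q g)"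
    and \<phi>: "\<phi> \<in> borel_measurable (borel \<Otimes>\<^sub>M count_space UNIV)"
    and int: "integrable M (\<lambda>\<omega>. \<phi> (Yp q t \<omega>, Tp q \<omega>))"
  shows "condE M (cell q g) (\<lambda>\<omega>. \<phi> (Yp q t \<omega>, Tp q \<omega>)) = condE M (Xcell M X (xs g)) (\<lambda>\<omega>. \<phi> (Yp q t \<omega>, Tp q \<omega>))"
proof -
  have "(\<lambda>\<omega>. (Yp q t \<omega>, Tp q \<omega>)) \<in> M \<rightarrow>\<^sub>M borel \<Otimes>\<^sub>M count_space UNIV"
    by measurable
  then show ?thesis
    using condE_refine_indep[OF Xcell_in_events _ independence[OF Xcell_pos_of_cell_pos[OF pos]] _ Q_measurable \<phi> int]
      pos unfolding cell_def by simp
qed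

lemma condE_cell_Tobs:
  assumes "0 < prob (cell q g)"
  shows "condE M (cell q g) (Tobs Q Tp) = condE M (Xcell M X (xs g)) (\<lambda>\<omega>. of_bool (Tp q \<omega>))"
proof -
  have "condE M (cell q g) (Tobs Q Tp) = condE M (cell q g) (\<lambda>\<omega>. of_bool (snd (Yp q True \<omega>, Tp q \<omega>)))"
    by (intro condE_cong_AE AE_I2) (auto simp: cell_def Tobs_def)
  also have "\<dots> = condE M (Xcell M X (xs g)) (\<lambda>\<omega>. of_bool (snd (Yp q True \<omega>, Tp q \<omega>)))"
    using integrable_of_bool_Tp by (intro condE_cell_eq_condE_Xcell assms) simp_all
  finally show ?thesis by simp
qed

lemma condE_cell_Yobs:
  assumes pos: "0 < prob (cell q g)"
  shows "condE M (cell q g) (Yobs Q Tp Yp) = condE M (Xcell M X (xs g)) (\<lambda>\<omega>. Yp q (Tp q \<omega>) \<omega>)"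
proof -
  define \<phi> :: "bool \<Rightarrow> real \<times> bool \<Rightarrow> real" where "\<phi> t z = of_bool (snd z = t) * fst z" for t z
  have [measurable]: "\<phi> t \<in> borel_measurable (borel \<Otimes>\<^sub>M count_space UNIV)" for t
    unfolding \<phi>_def by measurable
  have int: "integrable M (\<lambda>\<omega>. \<phi> t (Yp q t \<omega>, Tp q \<omega>))" for t
    unfolding \<phi>_def by (rule integrable_bounded_mult[where B = 1]) (simp_all add: Yp_integrable)
  have split: "Yp q (Tp q \<omega>) \<omega> = \<phi> True (Yp q True \<omega>, Tp q \<omega>) + \<phi> False (Yp q False \<omega>, Tp q \<omega>)" for \<omega>
    by (simp add: \<phi>_def)
  have "condE M (cell q g) (Yobs Q Tp Yp)
      = condE M (cell q g) (\<lambda>\<omega>. \<phi> True (Yp q True \<omega>, Tp q \<omega>) + \<phi> False (Yp q False \<omega>, Tp q \<omega>))"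
    by (intro condE_cong_AE AE_I2) (auto simp: cell_def Yobs_def split)
  also have "\<dots> = condE M (Xcell M X (xs g)) (\<lambda>\<omega>. \<phi> True (Yp q True \<omega>, Tp q \<omega>))
      + condE M (Xcell M X (xs g)) (\<lambda>\<omega>. \<phi> False (Yp q False \<omega>, Tp q \<omega>))"
    using int by (simp add: condE_add condE_cell_eq_condE_Xcell[OF pos])
  also have "\<dots> = condE M (Xcell M X (xs g)) (\<lambda>\<omega>. Yp q (Tp q \<omega>) \<omega>)"
    using int by (simp add: condE_add split)
  finally show ?thesis .
qed

lemma iv_contrast_Tobs:
  assumes "0 < prob (cell True g)" "0 < prob (cell False g)"
  shows "iv_contrast (Tobs Q Tp) g = condE M (Xcell M X (xs g)) (\<lambda>\<omega>. of_bool (Tp True \<omega>) - of_bool (Tp False \<omega>))"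
  unfolding iv_contrast_def condE_cell_Tobs[OF assms(1)] condE_cell_Tobs[OF assms(2)]
  by (simp add: condE_diff integrable_of_bool_Tp)

lemma iv_contrast_Yobs:
  assumes pos: "0 < prob (cell True g)" "0 < prob (cell False g)"
  shows "iv_contrast (Yobs Q Tp Yp) g = condE M (Xcell M X (xs g))
    (\<lambda>\<omega>. (of_bool (Tp True \<omega>) - of_bool (Tp False \<omega>)) * (Yp False True \<omega> - Yp False False \<omega>))"
proof -
  have excl: "AE \<omega> in M. \<omega> \<in> Xcell M X (xs g) \<longrightarrow> \<omega> \<in> {\<omega> \<in> space M. Yp True t \<omega> = Yp False t \<omega>}" for t
    using Xcell_pos_of_cell_pos[OF pos(1)]
    by (intro AE_of_condP_eq_1 exclusion) (simp_all, measurable)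
  have "AE \<omega> in M. \<omega> \<in> Xcell M X (xs g) \<longrightarrow> Yp True (Tp True \<omega>) \<omega> - Yp False (Tp False \<omega>) \<omega>
      = (of_bool (Tp True \<omega>) - of_bool (Tp False \<omega>)) * (Yp False True \<omega> - Yp False False \<omega>)"
    using excl[of True] excl[of False]
  proof eventually_elim
    case (elim \<omega>)
    then show ?case by (cases "Tp True \<omega>"; cases "Tp False \<omega>") simp_all
  qed
  then show ?thesis
    unfolding iv_contrast_def condE_cell_Yobs[OF pos(1)] condE_cell_Yobs[OF pos(2)]
    by (simp add: condE_diff[symmetric] integrable_Yp_Tp condE_cong_AE)
qed

lemma compliers_in_events[measurable]: "compliers M Tp \<in> events"
  unfolding compliers_def by measurable

lemma Tp_le_in_events[measurable]: "{\<omega> \<in> space M. Tp a \<omega> \<le> Tp b \<omega>} \<in> events"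
proof -
  have "{\<omega> \<in> space M. Tp a \<omega> \<le> Tp b \<omega>} = {\<omega> \<in> space M. Tp a \<omega> \<longrightarrow> Tp b \<omega>}" by auto
  then show ?thesis by simp
qed

lemma compliance_sign:
  assumes "0 < prob (Xcell M X (xs g))"
  obtains s :: real where "s = 1 \<or> s = -1"
    "AE \<omega> in M. \<omega> \<in> Xcell M X (xs g) \<longrightarrow>
       of_bool (Tp True \<omega>) - of_bool (Tp False \<omega>) = s * indicator (Xcell M X (xs g) \<inter> compliers M Tp) \<omega>"
  using monotonicity[OF assms]
proof
  assume "condP M (Xcell M X (xs g)) {\<omega> \<in> space M. Tp False \<omega> \<le> Tp True \<omega>} = 1"
  with assms have "AE \<omega> in M. \<omega> \<in> Xcell M X (xs g) \<longrightarrow> \<omega> \<in> {\<omega> \<in> space M. Tp False \<omega> \<le> Tp True \<omega>}"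
    by (intro AE_of_condP_eq_1) simp_all
  then have ae: "AE \<omega> in M. \<omega> \<in> Xcell M X (xs g) \<longrightarrow>
      of_bool (Tp True \<omega>) - of_bool (Tp False \<omega>) = (1::real) * indicator (Xcell M X (xs g) \<inter> compliers M Tp) \<omega>"
    by (rule eventually_mono) (auto simp: Xcell_def compliers_def)
  show ?thesis
    using that[OF _ ae] by simp
next
  assume "condP M (Xcell M X (xs g)) {\<omega> \<in> space M. Tp True \<omega> \<le> Tp False \<omega>} = 1"
  with assms have "AE \<omega> in M. \<omega> \<in> Xcell M X (xs g) \<longrightarrow> \<omega> \<in> {\<omega> \<in> space M. Tp True \<omega> \<le> Tp False \<omega>}"
    by (intro AE_of_condP_eq_1) simp_all
  then have ae: "AE \<omega> in M. \<omega> \<in> Xcell M X (xs g) \<longrightarrow>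
      of_bool (Tp True \<omega>) - of_bool (Tp False \<omega>) = (-1::real) * indicator (Xcell M X (xs g) \<inter> compliers M Tp) \<omega>"
    by (rule eventually_mono) (auto simp: Xcell_def compliers_def)
  show ?thesis
    using that[OF _ ae] by simp
qed

text \<open>Under monotonicity the instrument moves the treatment exactly on the compliers, all in one
  direction \<open>s\<close>, which cancels in both products. No relevance assumption is needed: where
  \<open>\<pi>(x\<^sub>g) = 0\<close> both sides vanish.\<close>
lemma iv_contrast_wald:
  assumes pos: "0 < prob (cell True g)" "0 < prob (cell False g)"
  shows "iv_contrast (Tobs Q Tp) g ^ 2 = pi_x M X Tp (xs g) ^ 2"
    and "iv_contrast (Tobs Q Tp) g * iv_contrast (Yobs Q Tp Yp) g
      = pi_x M X Tp (xs g) ^ 2 * tau_x M X Tp Yp (xs g)"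
proof -
  define C K where "C = Xcell M X (xs g)" and "K = Xcell M X (xs g) \<inter> compliers M Tp"
  have [measurable]: "K \<in> events" and "K \<subseteq> C" "C \<in> events"
    unfolding C_def K_def by auto
  obtain s :: real where s: "s = 1 \<or> s = -1"
    and ae: "AE \<omega> in M. \<omega> \<in> C \<longrightarrow> of_bool (Tp True \<omega>) - of_bool (Tp False \<omega>) = s * indicator K \<omega>"
    unfolding C_def K_def by (rule compliance_sign[OF Xcell_pos_of_cell_pos[OF pos(1)]])
  have pi: "pi_x M X Tp (xs g) = condP M C K"
    and tau: "tau_x M X Tp Yp (xs g) = condE M K (\<lambda>\<omega>. Yp False True \<omega> - Yp False False \<omega>)"
    unfolding pi_x_def tau_x_def condP_def C_def K_def by (simp_all add: Int_assoc)
  have "iv_contrast (Tobs Q Tp) g = condE M C (\<lambda>\<omega>. s * indicator K \<omega>)"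
    unfolding iv_contrast_Tobs[OF pos] C_def[symmetric] using ae \<open>C \<in> events\<close>
    by (intro condE_cong_AE) simp_all
  also have "\<dots> = s * pi_x M X Tp (xs g)"
    using \<open>K \<subseteq> C\<close> by (simp add: condE_cmult condE_indicator pi)
  finally have T: "iv_contrast (Tobs Q Tp) g = s * pi_x M X Tp (xs g)" .
  have "iv_contrast (Yobs Q Tp Yp) g = condE M C (\<lambda>\<omega>. s * (indicator K \<omega> * (Yp False True \<omega> - Yp False False \<omega>)))"
    unfolding iv_contrast_Yobs[OF pos] C_def[symmetric] using ae \<open>C \<in> events\<close>
    by (intro condE_cong_AE) (auto elim!: eventually_mono)
  also have "\<dots> = s * (pi_x M X Tp (xs g) * tau_x M X Tp Yp (xs g))"
    using \<open>K \<subseteq> C\<close> \<open>C \<in> events\<close> by (simp add: condE_cmult condE_indicator_mult pi tau)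
  finally have Y: "iv_contrast (Yobs Q Tp Yp) g = s * (pi_x M X Tp (xs g) * tau_x M X Tp Yp (xs g))" .
  from s show "iv_contrast (Tobs Q Tp) g ^ 2 = pi_x M X Tp (xs g) ^ 2"
    "iv_contrast (Tobs Q Tp) g * iv_contrast (Yobs Q Tp Yp) g
      = pi_x M X Tp (xs g) ^ 2 * tau_x M X Tp Yp (xs g)"
    unfolding T Y by (auto simp: power2_eq_square)
qed

lemma QXevent_eq_box: "QXevent M Q X xs qv gv = Pi\<^sub>E UNIV (\<lambda>k. cell (qv k) (gv k))"
  unfolding QXevent_def SampM_def cell_def Xcell_def by (auto simp: space_PiM PiE_iff)

lemma QXevent_i_eq_box:
  "QXevent_i M Q X xs qv gv i = Pi\<^sub>E UNIV ((\<lambda>_. space M)(i := cell (qv i) (gv i)))"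
  unfolding QXevent_i_def SampM_def cell_def Xcell_def by (force simp: space_PiM PiE_iff split: if_splits)

lemma cell_pos_of_realized:
  fixes qv :: "'n::finite \<Rightarrow> bool" and gv :: "'n \<Rightarrow> 'g"
  assumes "0 < measure (SampM M) (QXevent M Q X xs qv gv)"
  shows "0 < prob (cell (qv k) (gv k))"
proof -
  have "(\<Prod>k\<in>UNIV. prob (cell (qv k) (gv k))) \<noteq> 0"
    using assms unfolding QXevent_eq_box measure_SampM_box[of "\<lambda>k. cell (qv k) (gv k)", OF cell_in_events]
    by (metis less_irrefl)
  then have "prob (cell (qv k) (gv k)) \<noteq> 0"
    by (simp add: prod_zero_iff)
  then show ?thesis
    using measure_nonneg[of M "cell (qv k) (gv k)"] by linarith
qed

lemma cell_pos_of_arms: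
  fixes qv :: "'n::finite \<Rightarrow> bool" and gv :: "'n \<Rightarrow> 'g"
  assumes "0 < measure (SampM M) (QXevent M Q X xs qv gv)"
    and "0 < m_g qv gv g" "m_g qv gv g < n_g gv g"
  shows "0 < prob (cell q g)"
proof -
  have "{i. qv i \<and> gv i = g} \<noteq> {}" "{i. gv i = g} \<noteq> {i. qv i \<and> gv i = g}"
    using assms(2,3) unfolding m_g_def n_g_def by (auto simp: card_gt_0_iff)
  then obtain k where "qv k = q" "gv k = g"
    by (cases q) auto
  then show ?thesis
    using cell_pos_of_realized[OF assms(1), of k] by simp
qed

lemma condE_QXevent_i:
  fixes qv :: "'n::finite \<Rightarrow> bool" and gv :: "'n \<Rightarrow> 'g"
  assumes "0 < prob (cell (qv i) (gv i))" "integrable M f"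
  shows "condE (SampM M) (QXevent_i M Q X xs qv gv i) (\<lambda>\<omega>. f (\<omega> i)) = condE M (cell (qv i) (gv i)) f"
proof -
  define A where "A = (\<lambda>_. space M)(i := cell (qv i) (gv i))"
  have "\<And>k. A k \<in> events" "\<And>k. 0 < prob (A k)"
    using assms(1) by (auto simp: A_def prob_space)
  from condE_SampM_box_coord[of A f i, OF this assms(2)] show ?thesis
    unfolding QXevent_i_eq_box A_def[symmetric] by (simp add: A_def)
qed

lemma E_u_eps_eq:
  fixes qv :: "'n::finite \<Rightarrow> bool" and gv :: "'n \<Rightarrow> 'g"
  assumes pos: "0 < prob (cell (qv i) (gv i))"
  shows "E_u_eps M Q X Tp Yp xs qv gv i = condCov M (cell (qv i) (gv i)) (Tobs Q Tp) (Yobs Q Tp Yp)"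
proof -
  define a b where "a = condE M (cell (qv i) (gv i)) (Tobs Q Tp)"
    and "b = condE M (cell (qv i) (gv i)) (Yobs Q Tp Yp)"
  have int: "integrable M (\<lambda>\<omega>. (Tobs Q Tp \<omega> - a) * (Yobs Q Tp Yp \<omega> - b))"
    by (simp add: left_diff_distrib right_diff_distrib integrable_Tobs_mult integrable_Tobs integrable_Yobs)
  have "E_u_eps M Q X Tp Yp xs qv gv i
      = condE (SampM M) (QXevent_i M Q X xs qv gv i) (\<lambda>\<omega>. (Tobs Q Tp (\<omega> i) - a) * (Yobs Q Tp Yp (\<omega> i) - b))"
    unfolding E_u_eps_def Let_def a_def b_def
      condE_QXevent_i[where qv = qv and gv = gv and i = i, OF pos integrable_Tobs] condE_QXevent_i[where qv = qv and gv = gv and i = i, OF pos integrable_Yobs] ..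
  also have "\<dots> = condE M (cell (qv i) (gv i)) (\<lambda>\<omega>. (Tobs Q Tp \<omega> - a) * (Yobs Q Tp Yp \<omega> - b))"
    by (rule condE_QXevent_i[where qv = qv and gv = gv and i = i, OF pos int])
  also have "\<dots> = condCov M (cell (qv i) (gv i)) (Tobs Q Tp) (Yobs Q Tp Yp)"
    unfolding a_def b_def using pos
    by (intro condE_centred_mult integrable_Tobs integrable_Yobs integrable_Tobs_mult) simp_all
  finally show ?thesis .
qed

lemma E_u_sq_eq:
  fixes qv :: "'n::finite \<Rightarrow> bool" and gv :: "'n \<Rightarrow> 'g"
  assumes pos: "0 < prob (cell (qv i) (gv i))"
  shows "E_u_sq M Q X Tp xs qv gv i = condCov M (cell (qv i) (gv i)) (Tobs Q Tp) (Tobs Q Tp)"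
proof -
  define a where "a = condE M (cell (qv i) (gv i)) (Tobs Q Tp)"
  have int: "integrable M (\<lambda>\<omega>. (Tobs Q Tp \<omega> - a) * (Tobs Q Tp \<omega> - a))"
    by (simp add: left_diff_distrib right_diff_distrib integrable_Tobs_mult integrable_Tobs)
  have "E_u_sq M Q X Tp xs qv gv i
      = condE (SampM M) (QXevent_i M Q X xs qv gv i) (\<lambda>\<omega>. (Tobs Q Tp (\<omega> i) - a) * (Tobs Q Tp (\<omega> i) - a))"
    unfolding E_u_sq_def Let_def a_def power2_eq_square condE_QXevent_i[where qv = qv and gv = gv and i = i, OF pos integrable_Tobs] ..
  also have "\<dots> = condE M (cell (qv i) (gv i)) (\<lambda>\<omega>. (Tobs Q Tp \<omega> - a) * (Tobs Q Tp \<omega> - a))"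
    by (rule condE_QXevent_i[where qv = qv and gv = gv and i = i, OF pos int])
  also have "\<dots> = condCov M (cell (qv i) (gv i)) (Tobs Q Tp) (Tobs Q Tp)"
    unfolding a_def using pos
    by (intro condE_centred_mult integrable_Tobs integrable_Tobs_mult) simp_all
  finally show ?thesis .
qed

lemma condE_QXevent_Tvec_Pmat:
  fixes qv :: "'n::finite \<Rightarrow> bool" and gv :: "'n \<Rightarrow> 'g"
  assumes realized: "0 < measure (SampM M) (QXevent M Q X xs qv gv)"
    and arms: "\<And>g. 0 < m_g qv gv g" "\<And>g. m_g qv gv g < n_g gv g"
    and F: "integrable M F"
  shows "condE (SampM M) (QXevent M Q X xs qv gv)
      (\<lambda>\<omega>. Tvec Q Tp \<omega> \<bullet> (Pmat (Wmat gv) (Zmat qv gv) *v (\<chi> i. F (\<omega> i))))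
    = (\<Sum>g\<in>UNIV. real (n_g gv g) * Vtilde qv gv g * iv_contrast (Tobs Q Tp) g * iv_contrast F g)
      + (\<Sum>i\<in>UNIV. Pmat (Wmat gv) (Zmat qv gv) $ i $ i * condCov M (cell (qv i) (gv i)) (Tobs Q Tp) F)"
proof -
  let ?P = "Pmat (Wmat gv) (Zmat qv gv)"
  have split: "condE M (cell (qv i) (gv i)) f
      = condE M (cell False (gv i)) f + of_bool (qv i) * iv_contrast f (gv i)" for i f
    by (cases "qv i") (simp_all add: iv_contrast_def)
  have "condE (SampM M) (QXevent M Q X xs qv gv) (\<lambda>\<omega>. Tvec Q Tp \<omega> \<bullet> (?P *v (\<chi> i. F (\<omega> i))))
      = (\<Sum>i\<in>UNIV. \<Sum>j\<in>UNIV. ?P $ i $ j * condE M (cell (qv i) (gv i)) (Tobs Q Tp)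
          * condE M (cell (qv j) (gv j)) F)
        + (\<Sum>i\<in>UNIV. ?P $ i $ i * condCov M (cell (qv i) (gv i)) (Tobs Q Tp) F)"
    unfolding QXevent_eq_box Tvec_def using cell_pos_of_realized[OF realized]
    by (intro condE_SampM_box_bilinear integrable_Tobs F integrable_Tobs_mult cell_in_events)
  also have "(\<Sum>i\<in>UNIV. \<Sum>j\<in>UNIV. ?P $ i $ j * condE M (cell (qv i) (gv i)) (Tobs Q Tp)
          * condE M (cell (qv j) (gv j)) F)
      = (\<Sum>g\<in>UNIV. real (n_g gv g) * Vtilde qv gv g * iv_contrast (Tobs Q Tp) g * iv_contrast F g)"
    unfolding split
    by (rule Pmat_quadratic_form[where a = "\<lambda>g. condE M (cell False g) (Tobs Q Tp)"
          and d = "\<lambda>g. iv_contrast (Tobs Q Tp) g" and b = "\<lambda>g. condE M (cell False g) F"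
          and e = "\<lambda>g. iv_contrast F g", OF arms])
  finally show ?thesis .
qed

lemma beta_TSLS_eq:
  fixes qv :: "'n::finite \<Rightarrow> bool" and gv :: "'n \<Rightarrow> 'g"
  assumes realized: "0 < measure (SampM M) (QXevent M Q X xs qv gv)"
    and arms: "\<And>g. 0 < m_g qv gv g" "\<And>g. m_g qv gv g < n_g gv g"
  shows "beta_TSLS M Q X Tp Yp xs qv gv =
    ((\<Sum>g\<in>UNIV. real (n_g gv g) * Vtilde qv gv g
          * (iv_contrast (Tobs Q Tp) g * iv_contrast (Yobs Q Tp Yp) g))
      + (\<Sum>i\<in>UNIV. Pmat (Wmat gv) (Zmat qv gv) $ i $ i * E_u_eps M Q X Tp Yp xs qv gv i))
    / ((\<Sum>g\<in>UNIV. real (n_g gv g) * Vtilde qv gv g * iv_contrast (Tobs Q Tp) g ^ 2)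
      + (\<Sum>i\<in>UNIV. Pmat (Wmat gv) (Zmat qv gv) $ i $ i * E_u_sq M Q X Tp xs qv gv i))"
  unfolding beta_TSLS_def Let_def Yvec_def
    E_u_eps_eq[where qv = qv and gv = gv, OF cell_pos_of_realized[OF realized]]
    E_u_sq_eq[where qv = qv and gv = gv, OF cell_pos_of_realized[OF realized]]
    condE_QXevent_Tvec_Pmat[OF realized arms integrable_Yobs]
    condE_QXevent_Tvec_Pmat[OF realized arms integrable_Tobs, folded Tvec_def]
  by (simp add: power2_eq_square mult.assoc)

end

theorem lemma2:
  fixes M :: "'a measure"
    and Q :: "'a \<Rightarrow> bool"
    and X :: "'a \<Rightarrow> 'x"
    and Tp :: "bool \<Rightarrow> 'a \<Rightarrow> bool"
    and Yp :: "bool \<Rightarrow> bool \<Rightarrow> 'a \<Rightarrow> real"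
    and xs :: "'g::finite \<Rightarrow> 'x"
    and qv :: "'n::finite \<Rightarrow> bool"
    and gv :: "'n \<Rightarrow> 'g"
  assumes M: "prob_space M"
    and Q_meas: "Q \<in> M \<rightarrow>\<^sub>M count_space UNIV"
    and X_meas: "X \<in> M \<rightarrow>\<^sub>M count_space UNIV"
    and T_meas: "\<And>q. Tp q \<in> M \<rightarrow>\<^sub>M count_space UNIV"
    and Y_meas: "\<And>q t. Yp q t \<in> borel_measurable M"
    and Y_sq_int: "\<And>q t. integrable M (\<lambda>\<omega>. (Yp q t \<omega>)^2)"
    and xs_inj: "inj xs"
    and X_range: "\<And>\<omega>. \<omega> \<in> space M \<Longrightarrow> X \<omega> \<in> range xs"
    and independence: "\<And>q t g. measure M (Xcell M X (xs g)) > 0 \<Longrightarrow>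
        prob_space.indep_set (uniform_measure M (Xcell M X (xs g)))
          {(\<lambda>\<omega>. (Yp q t \<omega>, Tp q \<omega>)) -` A \<inter> space M | A. A \<in> sets (borel \<Otimes>\<^sub>M count_space UNIV)}
          {Q -` B \<inter> space M | B. B \<in> sets (count_space UNIV)}"
    and exclusion: "\<And>t g. measure M (Xcell M X (xs g)) > 0 \<Longrightarrow>
        condP M (Xcell M X (xs g)) {\<omega> \<in> space M. Yp True t \<omega> = Yp False t \<omega>} = 1"
    and relevance: "\<And>g. measure M (Xcell M X (xs g)) > 0 \<Longrightarrow> pi_x M X Tp (xs g) > 0"
    and monotonicity:
      "(\<forall>g. measure M (Xcell M X (xs g)) > 0 \<longrightarrow>
            condP M (Xcell M X (xs g)) {\<omega> \<in> space M. Tp True \<omega> \<ge> Tp False \<omega>} = 1)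
     \<or> (\<forall>g. measure M (Xcell M X (xs g)) > 0 \<longrightarrow>
            condP M (Xcell M X (xs g)) {\<omega> \<in> space M. Tp True \<omega> \<le> Tp False \<omega>} = 1)"
    and realized: "measure (SampM M) (QXevent M Q X xs qv gv) > 0"
    and group_sizes: "\<And>g. m_g qv gv g \<ge> 2 \<and> n_g gv g - m_g qv gv g \<ge> 2"
  shows
    "(let n = real CARD('n);
          ng = (\<lambda>g. real (n_g gv g)); mg = (\<lambda>g. real (m_g qv gv g));
          Vt = (\<lambda>g. mg g / ng g * (1 - mg g / ng g));
          W = Wmat gv; Z = Zmat qv gv;
          Pii = (\<lambda>i. \<Sum>g\<in>UNIV. 1 / ng g * W $ i $ g * (Z $ i $ g - mg g / ng g)^2 / Vt g)
      in (\<forall>i. Pmat W Z $ i $ i = Pii i)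
       \<and> beta_TSLS M Q X Tp Yp xs qv gv =
          ((\<Sum>g\<in>UNIV. ng g / n * (pi_x M X Tp (xs g))^2 * Vt g * tau_x M X Tp Yp (xs g))
              + 1 / n * (\<Sum>i\<in>UNIV. E_u_eps M Q X Tp Yp xs qv gv i * Pii i))
          / ((\<Sum>g\<in>UNIV. ng g / n * (pi_x M X Tp (xs g))^2 * Vt g)
              + 1 / n * (\<Sum>i\<in>UNIV. E_u_sq M Q X Tp xs qv gv i * Pii i)))"
proof -
  interpret prob_space M by (rule M)
  interpret iv_model M Q X Tp Yp xs
    using Q_meas X_meas T_meas Y_meas square_integrable_imp_integrable[OF Y_meas Y_sq_int]
      independence exclusion monotonicity
    by unfold_locales auto
  have arms: "0 < m_g qv gv g" "m_g qv gv g < n_g gv g" for g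
    using group_sizes[of g] by auto
  have cells: "0 < prob (cell q g)" for q g
    using cell_pos_of_arms[OF realized arms] .
  have "real CARD('n) \<noteq> 0" by simp
  then have cancel: "(a / CARD('n) + b / CARD('n)) / (c / CARD('n) + d / CARD('n)) = (a + b) / (c + d)"
    for a b c d :: real
    by (simp add: add_divide_distrib[symmetric])
  show ?thesis
    unfolding Let_def Vtilde_def[symmetric] Pmat_diag[OF arms, symmetric] beta_TSLS_eq[OF realized arms]
      iv_contrast_wald[OF cells cells]
    by (simp add: sum_divide_distrib[symmetric] sum_distrib_left[symmetric] cancel mult_ac)
qed

end
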